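(* Let $n\in\mathbb{N}$, let $\lambda$ be a partition with $\ell(\lambda)\le 2n$, and let $\mu,\nu\subseteq\lambda$ be partitions with $\ell(\mu)\le n$ and $\nu$ even. Let ${}^-LR^\lambda_{\mu,\nu}=\{G_\mu(T): T\in LR(\lambda/\mu,\nu)\}$ be the set of left companions (left Gelfand-Tsetlin patterns) of $LR(\lambda/\mu,\nu)$, and ${}^-LRS^\lambda_{\mu,\nu}=\{G_\mu(T): T\in LRS(\lambda/\mu,\nu)\}$ the set of left companions of LR-Sundaram tableaux. Then $${}^-LR^\lambda_{\mu,\nu}\cap SpT_{2n}(\mu)={}^-LRS^\lambda_{\mu,\nu},$$ and this set of symplectic left Gelfand-Tsetlin patterns is in bijection, via $T\mapsto G_\mu(T)$, with the set $LRS(\lambda/\mu,\nu)$ of LR-Sundaram (symplectic LR) tableaux.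
   Context: Partitions are identified with Young diagrams $D(\cdot)$ (matrix coordinates); $\ell(\gamma)$ is the number of nonzero parts. A partition $\nu$ is even if $\nu_{2i-1}=\nu_{2i}$ for all $i\ge 1$. $[m]=\{1,\dots,m\}$. A semistandard tableau $T$ of shape $\lambda/\mu$ on $[2n]$ is a filling of $D(\lambda)$ with $T(i,j)=0$ for $(i,j)\in D(\mu)$, entries in $[2n]$ on $D(\lambda)\setminus D(\mu)$, weakly increasing along rows and, on $D(\lambda)\setminus D(\mu)$, strictly increasing down columns. $SST_{2n}(\mu)$ is the set of semistandard tableaux of straight shape $\mu$ with entries in $[2n]$. The weight of $T$ is the vector whose $i$th entry is the number of $i$'s in $T$. The reverse row word of $T$ reads the nonzero entries of each row right to left, rows from top to bottom. A word is Yamanouchi if every prefix has weight a partition. $LR(\lambda/\mu,\nu)$ is the set of semistandard tableaux of shape $\lambda/\mu$ on $[2n]$ of weight $\nu$ whose reverse row word is Yamanouchi. Left companion: for $T\in LR(\lambda/\mu,\nu)$ and $r=1,\dots,2n$, let $\mu^{(2n-r+1)}$ be the partition giving the shape occupied by the entries $<r$ (including the entries $0$ in the cells of $\mu$) in rows $r,r+1,\dots,2n$ of $T$; i.e. $\mu^{(2n-r+1)}_j$ is the number of cells in row $r+j-1$ of $T$ with entry $<r$, $1\le j\le 2n-r+1$. The nested sequence $\mu=\mu^{(2n)}\supseteq\cdots\supseteq\mu^{(1)}$ is a Gelfand-Tsetlin pattern and defines $G_\mu(T)\in SST_{2n}(\mu)$: the cells of $G_\mu(T)$ with entry $\le i$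 are exactly the cells of $\mu^{(i)}$. Semistandard tableaux and Gelfand-Tsetlin patterns are identified in this way. $LRS(\lambda/\mu,\nu)$ is the set of $T\in LR(\lambda/\mu,\nu)$ with the Sundaram property: whenever $T(k,j)=2i+1$ for some cell $(k,j)$ and integer $i\ge0$, then $k\le n+i$. $SpT_{2n}(\mu)$ is the set of symplectic $G\in SST_{2n}(\mu)$, i.e. those with $G(k,1)\ge 2k-1$ for all $k\in[\ell(\mu)]$. The set ${}^-LR^\lambda_{\mu,\nu}$ is the Berenstein-Gelfand-Zelevinsky LR model on left Gelfand-Tsetlin patterns. *)

theory Defs
  imports Main "HOL-Library.Sublist"
begin

text \<open>
  A partition is the function sending \<open>i \<ge> 1\<close> to its \<open>i\<close>-th part, padded with zeros. Parts, rows
  and columns are counted from 1; the value at 0 is fixed to 0, so that equal partitions are equal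
  functions. Containment of diagrams is the pointwise order on functions.
\<close>

definition is_partition :: "(nat \<Rightarrow> nat) \<Rightarrow> bool" where
  "is_partition p \<longleftrightarrow> p 0 = 0 \<and> (\<forall>i\<ge>1. p (Suc i) \<le> p i) \<and> finite {i. p i \<noteq> 0}"

definition num_parts :: "(nat \<Rightarrow> nat) \<Rightarrow> nat" where
  "num_parts p = card {i. p i \<noteq> 0}"

definition even_partition :: "(nat \<Rightarrow> nat) \<Rightarrow> bool" where
  "even_partition p \<longleftrightarrow> is_partition p \<and> (\<forall>i\<ge>1. p (2 * i - 1) = p (2 * i))"

definition diagram :: "(nat \<Rightarrow> nat) \<Rightarrow> (nat \<times> nat) set" where
  "diagram p = {(i, j). 1 \<le> i \<and> 1 \<le> j \<and> j \<le> p i}"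

text \<open>
  A tableau \<open>T\<close> has entry \<open>T i j\<close> in row \<open>i\<close> and column \<open>j\<close>. Besides the cells of \<open>\<mu>\<close>, all
  positions outside \<open>lam\<close> carry 0 as well, so that a tableau is determined by its filling.
\<close>

definition skew_SST :: "nat \<Rightarrow> (nat \<Rightarrow> nat) \<Rightarrow> (nat \<Rightarrow> nat) \<Rightarrow> (nat \<Rightarrow> nat \<Rightarrow> nat) set" where
  "skew_SST m lam \<mu> = {T.
     (\<forall>i j. (i, j) \<notin> diagram lam - diagram \<mu> \<longrightarrow> T i j = 0) \<and>
     (\<forall>(i, j) \<in> diagram lam - diagram \<mu>. T i j \<in> {1..m}) \<and>
     (\<forall>i j j'. (i, j) \<in> diagram lam \<and> (i, j') \<in> diagram lam \<and> j \<le> j' \<longrightarrow> T i j \<le> T i j') \<and>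
     (\<forall>i i' j. (i, j) \<in> diagram lam - diagram \<mu> \<and> (i', j) \<in> diagram lam - diagram \<mu> \<and> i < i'
        \<longrightarrow> T i j < T i' j)}"

definition SST :: "nat \<Rightarrow> (nat \<Rightarrow> nat) \<Rightarrow> (nat \<Rightarrow> nat \<Rightarrow> nat) set" where
  "SST m \<mu> = skew_SST m \<mu> (\<lambda>_. 0)"

definition tableau_weight :: "(nat \<Rightarrow> nat) \<Rightarrow> (nat \<Rightarrow> nat \<Rightarrow> nat) \<Rightarrow> nat \<Rightarrow> nat" where
  "tableau_weight lam T k = (if k = 0 then 0 else card {(i, j) \<in> diagram lam. T i j = k})"

definition reverse_row_word :: "(nat \<Rightarrow> nat) \<Rightarrow> (nat \<Rightarrow> nat \<Rightarrow> nat) \<Rightarrow> nat list" where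
  "reverse_row_word lam T =
     concat (map (\<lambda>i. filter (\<lambda>x. x \<noteq> 0) (map (T i) (rev [1..<Suc (lam i)])))
                 [1..<Suc (num_parts lam)])"

definition word_weight :: "nat list \<Rightarrow> nat \<Rightarrow> nat" where
  "word_weight w k = (if k = 0 then 0 else count_list w k)"

definition yamanouchi :: "nat list \<Rightarrow> bool" where
  "yamanouchi w \<longleftrightarrow> (\<forall>u. prefix u w \<longrightarrow> is_partition (word_weight u))"

definition LR ::
  "nat \<Rightarrow> (nat \<Rightarrow> nat) \<Rightarrow> (nat \<Rightarrow> nat) \<Rightarrow> (nat \<Rightarrow> nat) \<Rightarrow> (nat \<Rightarrow> nat \<Rightarrow> nat) set" where
  "LR n lam \<mu> \<nu> = {T \<in> skew_SST (2 * n) lam \<mu>.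
     tableau_weight lam T = \<nu> \<and> yamanouchi (reverse_row_word lam T)}"

definition LRS ::
  "nat \<Rightarrow> (nat \<Rightarrow> nat) \<Rightarrow> (nat \<Rightarrow> nat) \<Rightarrow> (nat \<Rightarrow> nat) \<Rightarrow> (nat \<Rightarrow> nat \<Rightarrow> nat) set" where
  "LRS n lam \<mu> \<nu> = {T \<in> LR n lam \<mu> \<nu>.
     \<forall>k j i. (k, j) \<in> diagram lam \<and> T k j = 2 * i + 1 \<longrightarrow> k \<le> n + i}"

definition SpT :: "nat \<Rightarrow> (nat \<Rightarrow> nat) \<Rightarrow> (nat \<Rightarrow> nat \<Rightarrow> nat) set" where
  "SpT n \<mu> = {G \<in> SST (2 * n) \<mu>. \<forall>k\<in>{1..num_parts \<mu>}. 2 * k - 1 \<le> G k 1}"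

text \<open>
  \<open>low_shape n lam T r\<close> is the shape occupied by the entries smaller than \<open>r\<close> (zeros included) in
  rows \<open>r, \<dots>, 2n\<close> of \<open>T\<close>; \<open>left_pattern n lam T k\<close> is the \<open>k\<close>-th member, \<open>0 \<le> k \<le> 2n\<close>, of the
  Gelfand-Tsetlin pattern, that is \<open>k = 2n - r + 1\<close>; the member for \<open>k = 0\<close> is empty.
\<close>

definition low_shape :: "nat \<Rightarrow> (nat \<Rightarrow> nat) \<Rightarrow> (nat \<Rightarrow> nat \<Rightarrow> nat) \<Rightarrow> nat \<Rightarrow> nat \<Rightarrow> nat" where
  "low_shape n lam T r j =
     (if 1 \<le> j \<and> r + j - 1 \<le> 2 * n
      then card {c. (r + j - 1, c) \<in> diagram lam \<and> T (r + j - 1) c < r} else 0)"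

definition left_pattern :: "nat \<Rightarrow> (nat \<Rightarrow> nat) \<Rightarrow> (nat \<Rightarrow> nat \<Rightarrow> nat) \<Rightarrow> nat \<Rightarrow> nat \<Rightarrow> nat" where
  "left_pattern n lam T k = low_shape n lam T (2 * n + 1 - k)"

text \<open>
  The tableau identified with a nested sequence \<open>g 0 \<subseteq> g 1 \<subseteq> \<dots> \<subseteq> g m\<close> of shapes, \<open>g 0\<close> being
  empty: an entry is the index of the first shape containing its cell.
\<close>

definition pattern_tableau :: "nat \<Rightarrow> (nat \<Rightarrow> nat \<Rightarrow> nat) \<Rightarrow> nat \<Rightarrow> nat \<Rightarrow> nat" where
  "pattern_tableau m g i j =
     (if (i, j) \<in> diagram (g m) then LEAST k. (i, j) \<in> diagram (g k) else 0)"

lemma pattern_tableau_le_iff: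
  assumes nested: "\<And>k l. k \<le> l \<Longrightarrow> l \<le> m \<Longrightarrow> g k \<le> g l" and "k \<le> m"
  shows "{(i, j) \<in> diagram (g m). pattern_tableau m g i j \<le> k} = diagram (g k)"
proof -
  have mono: "c \<in> diagram (g l)" if "c \<in> diagram (g k)" "k \<le> l" "l \<le> m" for c k l
    using that nested[of k l] by (force simp: diagram_def le_fun_def intro: order_trans)
  have "pattern_tableau m g i j \<le> k \<longleftrightarrow> (i, j) \<in> diagram (g k)"
    if "(i, j) \<in> diagram (g m)" for i j
  proof
    assume "pattern_tableau m g i j \<le> k"
    then have "(LEAST k. (i, j) \<in> diagram (g k)) \<le> k"
      using that by (simp add: pattern_tableau_def)
    then show "(i, j) \<in> diagram (g k)"
      using LeastI[of "\<lambda>k. (i, j) \<in> diagram (g k)", OF that] mono \<open>k \<le> m\<close> by blast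
  next
    assume "(i, j) \<in> diagram (g k)"
    then show "pattern_tableau m g i j \<le> k"
      using that by (simp add: pattern_tableau_def Least_le)
  qed
  then show ?thesis
    using mono[OF _ \<open>k \<le> m\<close> order_refl] by auto
qed

definition left_companion ::
  "nat \<Rightarrow> (nat \<Rightarrow> nat) \<Rightarrow> (nat \<Rightarrow> nat \<Rightarrow> nat) \<Rightarrow> nat \<Rightarrow> nat \<Rightarrow> nat" where
  "left_companion n lam T = pattern_tableau (2 * n) (left_pattern n lam T)"

definition left_LR ::
  "nat \<Rightarrow> (nat \<Rightarrow> nat) \<Rightarrow> (nat \<Rightarrow> nat) \<Rightarrow> (nat \<Rightarrow> nat) \<Rightarrow> (nat \<Rightarrow> nat \<Rightarrow> nat) set" where
  "left_LR n lam \<mu> \<nu> = left_companion n lam ` LR n lam \<mu> \<nu>"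

definition left_LRS ::
  "nat \<Rightarrow> (nat \<Rightarrow> nat) \<Rightarrow> (nat \<Rightarrow> nat) \<Rightarrow> (nat \<Rightarrow> nat) \<Rightarrow> (nat \<Rightarrow> nat \<Rightarrow> nat) set" where
  "left_LRS n lam \<mu> \<nu> = left_companion n lam ` LRS n lam \<mu> \<nu>"

end

theory Submission
  imports Defs
begin

text \<open>
  Writing \<open>a i r\<close> for the number of cells in row \<open>i\<close> of \<open>T\<close> with entry below \<open>r\<close>, the left companion
  records \<open>a i r\<close> for \<open>i \<ge> r\<close>. The Yamanouchi condition forces entries of row \<open>i\<close> to be at most
  \<open>i\<close>, so the remaining values are \<open>a i r = lam i\<close> and \<open>T\<close> can be recovered. The companion is
  symplectic iff row \<open>n + i + 1\<close> of \<open>T\<close> has no entry \<open>\<le> 2 * i\<close>. Under the Sundaram property this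
  holds because the first column, outside \<open>\<mu>\<close> from row \<open>n + 1\<close> on, increases strictly and has to skip
  the odd numbers that are too small. Conversely, symplecticity only leaves an entry \<open>2 * i + 1\<close> in
  row \<open>n + i + 1\<close> to be excluded: as \<open>\<nu>\<close> is even, it would be matched by an entry \<open>2 * i + 2\<close> in a
  lower row.
\<close>

section \<open>Partitions and the conditions on skew tableaux\<close>

lemma partition_antimono:
  assumes "is_partition p" "1 \<le> i" "i \<le> j"
  shows "p j \<le> p i"
  using assms(3,2)
proof (induction j rule: dec_induct)
  case (step k)
  then have "p (Suc k) \<le> p k" using assms(1) by (simp add: is_partition_def)
  then show ?case using step by simp
qed simp

text \<open>The support is closed downwards among positive indices, so an index \<open>i\<close> in
  it forces \<open>{1..i}\<close> into it and is at most its cardinality. A subset of an interval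
  with as many elements as the interval is all of it. Thus \<open>num_parts\<close>, defined as a
  cardinality, is the index of the last nonzero part.\<close>

lemma partition_support:
  assumes "is_partition p"
  shows "{i. p i \<noteq> 0} = {1..num_parts p}"
proof -
  let ?S = "{i. p i \<noteq> 0}"
  have fin: "finite ?S" and p0: "p 0 = 0" using assms by (auto simp: is_partition_def)
  have "i \<in> {1..card ?S}" if "i \<in> ?S" for i
  proof -
    have "{1..i} \<subseteq> ?S"
      using partition_antimono[OF assms] that by fastforce
    then have "card {1..i} \<le> card ?S" using fin card_mono by blast
    moreover have "i \<noteq> 0" using that p0 by (cases i) auto
    ultimately show ?thesis by simp
  qed
  then have "?S \<subseteq> {1..card ?S}" by blast
  then have "?S = {1..card ?S}" by (intro card_subset_eq) auto
  then show ?thesis by (simp add: num_parts_def)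
qed

lemma partition_pos_iff:
  assumes "is_partition p"
  shows "0 < p i \<longleftrightarrow> 1 \<le> i \<and> i \<le> num_parts p"
  using partition_support[OF assms] by (auto simp: set_eq_iff)

lemma diagram_iff: "(i, j) \<in> diagram p \<longleftrightarrow> 1 \<le> i \<and> 1 \<le> j \<and> j \<le> p i"
  by (simp add: diagram_def)

lemma skew_SSTD:
  assumes "T \<in> skew_SST m lam \<mu>"
  shows "(i, j) \<notin> diagram lam \<Longrightarrow> T i j = 0"
    and "(i, j) \<in> diagram \<mu> \<Longrightarrow> T i j = 0"
    and "(i, j) \<in> diagram lam \<Longrightarrow> (i, j) \<notin> diagram \<mu> \<Longrightarrow> 1 \<le> T i j \<and> T i j \<le> m"
    and "(i, j') \<in> diagram lam \<Longrightarrow> 1 \<le> j \<Longrightarrow> j \<le> j' \<Longrightarrow> T i j \<le> T i j'"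
    and "(i, j) \<in> diagram lam \<Longrightarrow> (i, j) \<notin> diagram \<mu> \<Longrightarrow> (i', j) \<in> diagram lam \<Longrightarrow>
      (i', j) \<notin> diagram \<mu> \<Longrightarrow> i < i' \<Longrightarrow> T i j < T i' j"
proof -
  note T = assms[unfolded skew_SST_def mem_Collect_eq]
  have out: "T i j = 0" if "(i, j) \<notin> diagram lam - diagram \<mu>" for i j
    using T[THEN conjunct1] that by blast
  have ins: "T i j \<in> {1..m}" if "(i, j) \<in> diagram lam - diagram \<mu>" for i j
    using T[THEN conjunct2, THEN conjunct1] that by blast
  have row: "T i j \<le> T i j'" if "(i, j) \<in> diagram lam" "(i, j') \<in> diagram lam" "j \<le> j'" for i j j'
    using T[THEN conjunct2, THEN conjunct2, THEN conjunct1] that by blast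
  have col: "T i j < T i' j"
    if "(i, j) \<in> diagram lam - diagram \<mu>" "(i', j) \<in> diagram lam - diagram \<mu>" "i < i'" for i i' j
    using T[THEN conjunct2, THEN conjunct2, THEN conjunct2] that by blast
  show "(i, j) \<notin> diagram lam \<Longrightarrow> T i j = 0" and "(i, j) \<in> diagram \<mu> \<Longrightarrow> T i j = 0"
    using out by auto
  show "(i, j) \<in> diagram lam \<Longrightarrow> (i, j) \<notin> diagram \<mu> \<Longrightarrow> 1 \<le> T i j \<and> T i j \<le> m"
    using ins[of i j] by auto
  show "(i, j') \<in> diagram lam \<Longrightarrow> 1 \<le> j \<Longrightarrow> j \<le> j' \<Longrightarrow> T i j \<le> T i j'"
    using row[of i j j'] by (simp add: diagram_iff)
  show "(i, j) \<in> diagram lam \<Longrightarrow> (i, j) \<notin> diagram \<mu> \<Longrightarrow> (i', j) \<in> diagram lam \<Longrightarrow>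
      (i', j) \<notin> diagram \<mu> \<Longrightarrow> i < i' \<Longrightarrow> T i j < T i' j"
    using col by blast
qed


subsection \<open>Reading words\<close>

definition row_word :: "(nat \<Rightarrow> nat) \<Rightarrow> (nat \<Rightarrow> nat \<Rightarrow> nat) \<Rightarrow> nat \<Rightarrow> nat list" where
  "row_word lam T i = filter (\<lambda>x. x \<noteq> 0) (map (T i) (rev [1..<Suc (lam i)]))"

lemma reverse_row_word_eq:
  "reverse_row_word lam T = concat (map (row_word lam T) [1..<Suc (num_parts lam)])"
  by (simp add: reverse_row_word_def row_word_def[abs_def] del: upt_Suc)

lemma set_row_word:
  assumes "1 \<le> i"
  shows "x \<in> set (row_word lam T i) \<longleftrightarrow> x \<noteq> 0 \<and> (\<exists>j. (i, j) \<in> diagram lam \<and> T i j = x)"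
  using assms unfolding row_word_def by (auto simp: diagram_iff)

lemma sorted_row_word:
  assumes "T \<in> skew_SST m lam \<mu>" "1 \<le> i"
  shows "sorted_wrt (\<ge>) (row_word lam T i)"
proof -
  have "sorted_wrt (\<lambda>a b. T i b \<le> T i a) (rev [1..<Suc (lam i)])"
    unfolding sorted_wrt_rev
    by (rule sorted_wrt_mono_rel[OF _ sorted_wrt_upt])
      (use skew_SSTD(4)[OF assms(1)] assms(2) in \<open>auto simp: diagram_iff\<close>)
  then show ?thesis
    unfolding row_word_def by (intro sorted_wrt_filter) (simp add: sorted_wrt_map)
qed

lemma reverse_row_word_split:
  assumes "1 \<le> i" "i \<le> num_parts lam"
  shows "reverse_row_word lam T = concat (map (row_word lam T) [1..<i]) @ row_word lam T i @
    concat (map (row_word lam T) [Suc i..<Suc (num_parts lam)])"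
proof -
  have "[1..<Suc (num_parts lam)] = [1..<i] @ i # [Suc i..<Suc (num_parts lam)]"
    using upt_add_eq_append[of 1 i "Suc (num_parts lam) - i"] upt_conv_Cons[of i "Suc (num_parts lam)"]
      assms by (simp del: upt_Suc)
  then show ?thesis by (simp add: reverse_row_word_eq del: upt_Suc)
qed

lemma yamanouchi_prefix:
  assumes "yamanouchi (u @ v)" "1 \<le> k"
  shows "count_list u (Suc k) \<le> count_list u k"
proof -
  have "is_partition (word_weight u)" using assms by (simp add: yamanouchi_def)
  then have "word_weight u (Suc k) \<le> word_weight u k" using assms by (simp add: is_partition_def)
  then show ?thesis using assms by (simp add: word_weight_def)
qed

text \<open>The first letter \<open>k\<close> read from a row is its largest. If
  \<open>k > 1\<close>, the prefix ending in it must contain \<open>k - 1\<close>; as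
  \<open>k\<close> is the only letter read from this row so far, \<open>k - 1\<close> lies in an
  earlier row, and induction bounds it by the number of that row.\<close>

lemma yamanouchi_entry_le_row:
  assumes "T \<in> skew_SST m lam \<mu>" "yamanouchi (reverse_row_word lam T)"
    "1 \<le> i" "i \<le> num_parts lam" "x \<in> set (row_word lam T i)"
  shows "x \<le> i"
  using assms(3-5)
proof (induction i arbitrary: x rule: less_induct)
  case (less i)
  let ?P = "concat (map (row_word lam T) [1..<i])"
  obtain k r where kr: "row_word lam T i = k # r"
    using less.prems by (cases "row_word lam T i") auto
  have "x \<le> k"
    using sorted_row_word[OF assms(1), of i] less.prems kr by auto
  moreover have "k \<le> i"
  proof (cases "k \<le> 1")
    case False
    obtain q where q: "k = Suc q" "1 \<le> q" using False by (cases k) auto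
    obtain v where "reverse_row_word lam T = (?P @ [k]) @ v"
      using reverse_row_word_split[of i lam T] less.prems kr by auto
    then have "count_list (?P @ [k]) k \<le> count_list (?P @ [k]) q"
      using yamanouchi_prefix[of "?P @ [k]" v q] assms(2) q by simp
    \<comment> \<open>The last letter of the prefix makes the count of \<open>k\<close> positive
      and, being different from \<open>q\<close>, adds nothing to the count of
      \<open>q\<close>.\<close>
    then have "0 < count_list ?P q" using q by simp
    then have "q \<in> set ?P" by (metis count_list_0_iff less_irrefl)
    then obtain i' where "1 \<le> i'" "i' < i" "q \<in> set (row_word lam T i')" by auto
    then show ?thesis using less.IH[of i' q] less.prems q by simp
  qed (use less.prems in simp)
  ultimately show ?case by simp
qed

lemma card_Collect_Sigma_nat:
  assumes "\<And>i. finite (A i)"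
  shows "card {(i, j). i \<in> set [a..<b] \<and> j \<in> A i} = (\<Sum>i\<leftarrow>[a..<b]. card (A i))"
proof -
  have "{(i, j). i \<in> set [a..<b] \<and> j \<in> A i} = Sigma {a..<b} A" by auto
  then show ?thesis using assms by (simp add: interv_sum_list_conv_sum_set_nat)
qed

lemma count_row_word:
  assumes "k \<noteq> 0"
  shows "count_list (row_word lam T i) k = card {j. 1 \<le> j \<and> j \<le> lam i \<and> T i j = k}"
proof -
  have "count_list (row_word lam T i) k = length (filter (\<lambda>j. T i j = k) (rev [1..<Suc (lam i)]))"
    using assms
    by (auto simp: row_word_def count_list_eq_length_filter filter_map o_def simp del: upt_Suc
        intro!: arg_cong[where f = length] filter_cong)
  also have "\<dots> = card (set (filter (\<lambda>j. T i j = k) (rev [1..<Suc (lam i)])))"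
    by (intro distinct_card[symmetric] distinct_filter) simp
  also have "set (filter (\<lambda>j. T i j = k) (rev [1..<Suc (lam i)])) = {j. 1 \<le> j \<and> j \<le> lam i \<and> T i j = k}"
    by auto
  finally show ?thesis .
qed

lemma count_reverse_row_word:
  assumes "is_partition lam" "k \<noteq> 0"
  shows "count_list (reverse_row_word lam T) k = tableau_weight lam T k"
proof -
  let ?A = "\<lambda>i. {j. 1 \<le> j \<and> j \<le> lam i \<and> T i j = k}"
  have row: "1 \<le> i \<and> i \<le> num_parts lam" if "1 \<le> j" "j \<le> lam i" for i j
    using partition_pos_iff[OF assms(1), of i] that by linarith
  have count_concat: "count_list (concat xss) k = (\<Sum>xs\<leftarrow>xss. count_list xs k)" for xss :: "nat list list"
    by (induction xss) auto
  have "count_list (reverse_row_word lam T) k = (\<Sum>i\<leftarrow>[1..<Suc (num_parts lam)]. card (?A i))"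
    by (simp add: reverse_row_word_eq count_concat o_def count_row_word[OF assms(2)] del: upt_Suc)
  also have "\<dots> = card {(i, j). i \<in> set [1..<Suc (num_parts lam)] \<and> j \<in> ?A i}"
    by (rule card_Collect_Sigma_nat[symmetric]) simp
  also have "{(i, j). i \<in> set [1..<Suc (num_parts lam)] \<and> j \<in> ?A i} = {(i, j) \<in> diagram lam. T i j = k}"
    using row by (auto simp: diagram_iff less_Suc_eq_le simp del: upt_Suc)
  finally show ?thesis using assms(2) by (simp add: tableau_weight_def)
qed

text \<open>Cut the word just before an occurrence of \<open>k\<close> in row \<open>i\<close>. The
  rest of that row is at most \<open>k\<close>, so if no lower row contains \<open>Suc k\<close>,
  every \<open>Suc k\<close> precedes the cut. There the letters \<open>k\<close> are at least as
  many, and one more \<open>k\<close> follows: the two weights cannot agree.\<close>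

lemma yamanouchi_matching_entry_below:
  assumes lam: "is_partition lam" and T: "T \<in> skew_SST m lam \<mu>"
    and yam: "yamanouchi (reverse_row_word lam T)"
    and eq: "tableau_weight lam T k = tableau_weight lam T (Suc k)"
    and cell: "(i, j) \<in> diagram lam" "T i j = k" "1 \<le> k"
  shows "\<exists>i' j'. i < i' \<and> (i', j') \<in> diagram lam \<and> T i' j' = Suc k"
proof (rule ccontr)
  assume none: "\<not> ?thesis"
  let ?P = "concat (map (row_word lam T) [1..<i])"
  let ?Q = "concat (map (row_word lam T) [Suc i..<Suc (num_parts lam)])"
  have i: "1 \<le> i" "i \<le> num_parts lam"
    using cell partition_pos_iff[OF lam, of i] by (auto simp: diagram_iff)
  have "k \<in> set (row_word lam T i)" using set_row_word[OF i(1)] cell by auto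
  then obtain xs ys where xy: "row_word lam T i = xs @ k # ys" by (meson split_list)
  have "Suc k \<notin> set ys"
    using sorted_row_word[OF T i(1)] xy by (auto simp: sorted_wrt_append)
  then have cys: "count_list ys (Suc k) = 0" by simp
  have "Suc k \<notin> set ?Q"
  proof
    assume "Suc k \<in> set ?Q"
    then obtain i' where "i < i'" "Suc k \<in> set (row_word lam T i')"
      by (auto simp: Suc_le_eq simp del: upt_Suc)
    then show False using none set_row_word[of i'] by auto
  qed
  then have cQ: "count_list ?Q (Suc k) = 0" by (simp only: count_list_0_iff not_False_eq_True)
  have W: "reverse_row_word lam T = (?P @ xs) @ k # ys @ ?Q"
    using reverse_row_word_split[OF i] xy by simp
  have "count_list (?P @ xs) (Suc k) \<le> count_list (?P @ xs) k"
    using yamanouchi_prefix[of "?P @ xs" _ k] yam W cell by simp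
  moreover have "count_list (reverse_row_word lam T) (Suc k) = count_list (?P @ xs) (Suc k)"
    using W cys cQ by (simp del: upt_Suc)
  moreover have "count_list (reverse_row_word lam T) k > count_list (?P @ xs) k"
    using W by (simp del: upt_Suc)
  ultimately show False
    using eq count_reverse_row_word[OF lam, of k T] count_reverse_row_word[OF lam, of "Suc k" T] cell
    by simp
qed


subsection \<open>Tableaux of interlacing sequences\<close>

lemma pattern_tableau_le:
  assumes "\<And>k l. k \<le> l \<Longrightarrow> l \<le> m \<Longrightarrow> g k \<le> g l" "k \<le> m" "(i, j) \<in> diagram (g m)"
  shows "pattern_tableau m g i j \<le> k \<longleftrightarrow> (i, j) \<in> diagram (g k)"
  using pattern_tableau_le_iff[of m g k] assms by (auto simp: set_eq_iff)

lemma interlacing_nested: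
  fixes g :: "nat \<Rightarrow> nat \<Rightarrow> nat"
  assumes "\<And>k j. k < m \<Longrightarrow> g k j \<le> g (Suc k) j" "k \<le> l" "l \<le> m"
  shows "g k \<le> g l"
  using assms(2,3)
proof (induction l rule: dec_induct)
  case (step l)
  then have "g k \<le> g l" "g l \<le> g (Suc l)" using assms(1)[of l] by (auto simp: le_fun_def)
  then show ?case by (rule order_trans)
qed simp

text \<open>Interlacing says that each step \<open>g (Suc k)\<close> over \<open>g k\<close> is a
  horizontal strip: below a cell there is no cell added in the same step, which makes the columns
  strict. The empty \<open>g 0\<close> makes all entries positive.\<close>

lemma pattern_tableau_SST:
  assumes nested: "\<And>k j. k < m \<Longrightarrow> g k j \<le> g (Suc k) j"
    and lace: "\<And>k j. k < m \<Longrightarrow> 1 \<le> j \<Longrightarrow> g (Suc k) (Suc j) \<le> g k j"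
    and g0: "\<And>j. g 0 j = 0"
  shows "pattern_tableau m g \<in> SST m (g m)"
proof -
  let ?G = "pattern_tableau m g"
  have le: "?G i j \<le> k \<longleftrightarrow> (i, j) \<in> diagram (g k)" if "k \<le> m" "(i, j) \<in> diagram (g m)" for i j k
    by (rule pattern_tableau_le) (use interlacing_nested[of m g] nested that in auto)
  have ub: "?G i j \<le> m" if "(i, j) \<in> diagram (g m)" for i j
    using le that by blast
  have lb: "1 \<le> ?G i j" if "(i, j) \<in> diagram (g m)" for i j
    using le[of 0 i j] that g0 by (fastforce simp: diagram_iff)
  \<comment> \<open>The shapes are not assumed to be partitions; monotonicity comes from going up
    one step and back by interlacing:
    \<open>g k (Suc i') \<le> g (Suc k) (Suc i') \<le> g k i'\<close>.\<close>
  have anti: "g k i' \<le> g k i" if "k < m" "1 \<le> i" "i \<le> i'" for k i i'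
    using that(3,2)
  proof (induction i' rule: dec_induct)
    case (step i')
    then have "g k (Suc i') \<le> g k i'" using nested[OF that(1), of "Suc i'"] lace[OF that(1), of i'] by simp
    then show ?case using step by simp
  qed simp
  have row: "?G i j \<le> ?G i j'" if "(i, j) \<in> diagram (g m)" "(i, j') \<in> diagram (g m)" "j \<le> j'" for i j j'
    using le[OF ub, of i j' i j'] le[OF ub, of i j' i j] that by (auto simp: diagram_iff)
  have col: "?G i j < ?G i' j" if "(i, j) \<in> diagram (g m)" "(i', j) \<in> diagram (g m)" "i < i'" for i i' j
  proof -
    note ij = that
    have "1 \<le> ?G i' j" using lb that by blast
    then obtain k where k: "?G i' j = Suc k" by (cases "?G i' j") auto
    have km: "k < m" using ub[OF that(2)] k by simp
    have "(i', j) \<in> diagram (g (Suc k))" using le[of "Suc k" i' j] that k km by auto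
    moreover obtain i'' where "i' = Suc i''" "i \<le> i''" using ij(3) by (cases i') auto
    moreover have "1 \<le> i" using that by (simp add: diagram_iff)
    ultimately have "(i, j) \<in> diagram (g k)"
      using lace[OF km, of i''] anti[OF km, of i i''] by (simp add: diagram_iff)
    then show ?thesis using le[of k i j] that km k by simp
  qed
  have 0: "diagram (\<lambda>_. 0) = {}" by (auto simp: diagram_def)
  show ?thesis
    unfolding SST_def skew_SST_def 0 using row col ub lb
    by (auto simp: pattern_tableau_def)
qed


subsection \<open>The left companion\<close>

text \<open>The quantity \<open>a i r\<close> of the overview. It is available for every row,
  whereas \<open>low_shape\<close> records it only for rows from \<open>r\<close> on.\<close>

definition count_below :: "(nat \<Rightarrow> nat) \<Rightarrow> (nat \<Rightarrow> nat \<Rightarrow> nat) \<Rightarrow> nat \<Rightarrow> nat \<Rightarrow> nat" where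
  "count_below lam T i r = card {c. (i, c) \<in> diagram lam \<and> T i c < r}"

lemma finite_row: "finite {c. (i, c) \<in> diagram lam \<and> P c}"
  by (rule finite_subset[of _ "{..lam i}"]) (auto simp: diagram_iff)

text \<open>Rows increase weakly, so the cells with entry below \<open>r\<close> form an initial
  segment of the row and their number is the last column of that segment.\<close>

lemma le_count_below_iff:
  assumes T: "T \<in> skew_SST m lam \<mu>" and c: "1 \<le> c" and i: "1 \<le> i"
  shows "c \<le> count_below lam T i r \<longleftrightarrow> (i, c) \<in> diagram lam \<and> T i c < r"
proof -
  let ?S = "{c. (i, c) \<in> diagram lam \<and> T i c < r}"
  have down: "c \<in> ?S" if "c' \<in> ?S" "1 \<le> c" "c \<le> c'" for c c'
    using that skew_SSTD(4)[OF T, of i c' c] by (auto simp: diagram_iff)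
  show ?thesis
  proof
    assume le: "c \<le> count_below lam T i r"
    show "(i, c) \<in> diagram lam \<and> T i c < r"
    proof (rule ccontr)
      assume "\<not> ?thesis"
      then have "c \<notin> ?S" by simp
      then have "x \<in> {1..<c}" if "x \<in> ?S" for x
        using down[OF that c] that by (fastforce simp: diagram_iff not_le[symmetric])
      then have "?S \<subseteq> {1..<c}" by blast
      then have "card ?S \<le> card {1..<c}" by (intro card_mono) auto
      then show False using le c by (simp add: count_below_def)
    qed
  next
    assume "(i, c) \<in> diagram lam \<and> T i c < r"
    then have "{1..c} \<subseteq> ?S" using down[of c] by auto
    then have "card {1..c} \<le> card ?S" using finite_row by (intro card_mono) auto
    then show "c \<le> count_below lam T i r" by (simp add: count_below_def)
  qed
qed

text \<open>Lets counts be compared column by column through \<open>le_count_below_iff\<close>,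
  which speaks only of columns from 1 on.\<close>

lemma nat_leI:
  assumes "\<And>c::nat. 1 \<le> c \<Longrightarrow> c \<le> a \<Longrightarrow> c \<le> b"
  shows "a \<le> b"
  using assms[of a] by (cases a) auto

text \<open>With \<open>r = 2 * n + 1 - k\<close>, part \<open>j\<close> of member \<open>k\<close>
  is read from row \<open>r + j - 1 = 2 * n - k + j\<close>, which is at most \<open>2 * n\<close>
  exactly when \<open>j \<le> k\<close>. The bound on \<open>k\<close> keeps the truncated
  subtractions exact.\<close>

lemma left_pattern_eq:
  assumes "k \<le> 2 * n"
  shows "left_pattern n lam T k j =
    (if 1 \<le> j \<and> j \<le> k then count_below lam T (2 * n - k + j) (2 * n + 1 - k) else 0)"
proof -
  have "2 * n + 1 - k + j - 1 = 2 * n - k + j" using assms by simp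
  moreover have "2 * n - k + j \<le> 2 * n \<longleftrightarrow> j \<le> k" using assms by auto
  ultimately show ?thesis
    by (simp only: left_pattern_def low_shape_def count_below_def)
qed

lemma count_below_mono: "r \<le> s \<Longrightarrow> count_below lam T i r \<le> count_below lam T i s"
  unfolding count_below_def by (intro card_mono finite_row) auto

section \<open>The left pattern of a fixed skew tableau, and when it is symplectic\<close>

locale skew_tableau =
  fixes n :: nat and lam \<mu> :: "nat \<Rightarrow> nat" and T :: "nat \<Rightarrow> nat \<Rightarrow> nat"
  assumes lam: "is_partition lam" "num_parts lam \<le> 2 * n"
    and \<mu>: "is_partition \<mu>" "\<mu> \<le> lam"
    and T: "T \<in> skew_SST (2 * n) lam \<mu>"
begin

lemma diagram_\<mu>_lam: "c \<in> diagram \<mu> \<Longrightarrow> c \<in> diagram lam"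
  using \<mu>(2) by (auto simp: diagram_def le_fun_def intro: order_trans)

lemma diagram_row_le: "(i, j) \<in> diagram lam \<Longrightarrow> i \<le> 2 * n"
  using partition_pos_iff[OF lam(1), of i] lam(2) by (auto simp: diagram_iff)

lemma count_below_column:
  assumes "1 \<le> i" "1 \<le> r"
  shows "count_below lam T (Suc i) (Suc r) \<le> count_below lam T i r"
proof (rule nat_leI)
  fix c :: nat
  assume c: "1 \<le> c" and "c \<le> count_below lam T (Suc i) (Suc r)"
  then have below: "(Suc i, c) \<in> diagram lam" "T (Suc i) c < Suc r"
    using le_count_below_iff[OF T c, of "Suc i"] by auto
  have in_lam: "(i, c) \<in> diagram lam"
    using below partition_antimono[OF lam(1) assms(1), of "Suc i"] assms by (simp add: diagram_iff)
  have "T i c < r"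
  proof (cases "(i, c) \<in> diagram \<mu>")
    case True
    then show ?thesis using skew_SSTD(2)[OF T] assms by fastforce
  next
    case False
    \<comment> \<open>Column strictness compares only cells outside \<open>\<mu>\<close>; since
      \<open>\<mu>\<close> is a partition, a column that has left it does not reenter it further
      down.\<close>
    then have "(Suc i, c) \<notin> diagram \<mu>"
      using partition_antimono[OF \<mu>(1) assms(1), of "Suc i"] assms c by (simp add: diagram_iff)
    then show ?thesis using skew_SSTD(5)[OF T in_lam False below(1)] below by simp
  qed
  then show "c \<le> count_below lam T i r" using le_count_below_iff[OF T c assms(1)] in_lam by simp
qed

text \<open>From \<open>k\<close> to \<open>Suc k\<close> both the row of \<open>T\<close> and the
  bound on the entries drop by one, which is the situation of
  \<open>count_below_column\<close>.\<close>

lemma left_pattern_nested: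
  assumes "k < 2 * n"
  shows "left_pattern n lam T k j \<le> left_pattern n lam T (Suc k) j"
proof (cases "1 \<le> j \<and> j \<le> k")
  case True
  have "2 * n - k + j = Suc (2 * n - Suc k + j)" "2 * n + 1 - k = Suc (2 * n + 1 - Suc k)"
    and "1 \<le> 2 * n - Suc k + j" "1 \<le> 2 * n + 1 - Suc k"
    using assms True by auto
  then show ?thesis
    using True assms count_below_column[of "2 * n - Suc k + j" "2 * n + 1 - Suc k"]
    by (simp add: left_pattern_eq)
qed (use assms in \<open>simp add: left_pattern_eq\<close>)

text \<open>Both parts are read from the same row of \<open>T\<close>; only the bound on the entries
  differs.\<close>

lemma left_pattern_interlacing:
  assumes "k < 2 * n" "1 \<le> j"
  shows "left_pattern n lam T (Suc k) (Suc j) \<le> left_pattern n lam T k j"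
proof -
  have "2 * n - Suc k + Suc j = 2 * n - k + j" using assms by simp
  then show ?thesis
    using assms by (auto simp: left_pattern_eq intro: count_below_mono)
qed

lemma left_pattern_0: "left_pattern n lam T 0 j = 0"
  by (simp add: left_pattern_eq)

text \<open>Here \<open>r = 1\<close>, and the entries below 1 are the zeros in the cells of
  \<open>\<mu>\<close>. All rows of \<open>\<mu>\<close> are seen because \<open>lam\<close> has at
  most \<open>2 * n\<close> of them.\<close>

lemma left_pattern_top: "left_pattern n lam T (2 * n) = \<mu>"
proof
  fix j
  show "left_pattern n lam T (2 * n) j = \<mu> j"
  proof (cases "1 \<le> j \<and> j \<le> 2 * n")
    case True
    have "{c. (j, c) \<in> diagram lam \<and> T j c < 1} = {1..\<mu> j}"
    proof (intro set_eqI iffI)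
      fix c assume "c \<in> {c. (j, c) \<in> diagram lam \<and> T j c < 1}"
      then have "(j, c) \<in> diagram \<mu>" using skew_SSTD(3)[OF T, of j c] by fastforce
      then show "c \<in> {1..\<mu> j}" by (simp add: diagram_iff)
    next
      fix c assume "c \<in> {1..\<mu> j}"
      then have "(j, c) \<in> diagram \<mu>" using True by (simp add: diagram_iff)
      then show "c \<in> {c. (j, c) \<in> diagram lam \<and> T j c < 1}"
        using skew_SSTD(2)[OF T] diagram_\<mu>_lam by simp
    qed
    then have "count_below lam T j 1 = \<mu> j" by (simp add: count_below_def)
    then show ?thesis using True by (simp add: left_pattern_eq)
  next
    case False
    have "\<mu> j = 0"
    proof (rule ccontr)
      assume "\<mu> j \<noteq> 0"
      then have "1 \<le> j" using partition_pos_iff[OF \<mu>(1), of j] by simp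
      then have "(j, 1) \<in> diagram \<mu>" using \<open>\<mu> j \<noteq> 0\<close> by (simp add: diagram_iff)
      then show False using diagram_row_le diagram_\<mu>_lam False \<open>1 \<le> j\<close> by blast
    qed
    then show ?thesis using False by (auto simp: left_pattern_eq)
  qed
qed

lemma left_pattern_mono:
  "k \<le> l \<Longrightarrow> l \<le> 2 * n \<Longrightarrow> left_pattern n lam T k \<le> left_pattern n lam T l"
  by (rule interlacing_nested[where m = "2 * n"]) (auto intro: left_pattern_nested)

lemma left_companion_SST: "left_companion n lam T \<in> SST (2 * n) \<mu>"
  using pattern_tableau_SST[of "2 * n" "left_pattern n lam T", OF left_pattern_nested
      left_pattern_interlacing left_pattern_0]
  by (simp add: left_companion_def left_pattern_top)

lemma left_companion_le:
  assumes "k \<le> 2 * n" "(i, j) \<in> diagram \<mu>"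
  shows "left_companion n lam T i j \<le> k \<longleftrightarrow> (i, j) \<in> diagram (left_pattern n lam T k)"
  unfolding left_companion_def
  by (rule pattern_tableau_le) (use left_pattern_mono assms left_pattern_top in auto)

text \<open>Reads the pattern back from its tableau, so that equal companions give equal
  patterns.\<close>

lemma left_pattern_conv_companion:
  assumes "k \<le> 2 * n" "1 \<le> i" "1 \<le> j"
  shows "j \<le> left_pattern n lam T k i \<longleftrightarrow> (i, j) \<in> diagram \<mu> \<and> left_companion n lam T i j \<le> k"
proof -
  have "left_pattern n lam T k i \<le> \<mu> i"
    using left_pattern_mono[of k "2 * n"] assms by (simp add: left_pattern_top le_fun_def)
  then show ?thesis
    using left_companion_le[OF assms(1), of i j] assms by (auto simp: diagram_iff)
qed

text \<open>The companion violates the condition in row \<open>k\<close> when member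
  \<open>2 * k - 2\<close> of the pattern has a nonzero part \<open>k\<close>. That part counts the
  entries below \<open>2 * i + 1\<close> in row \<open>n + i + 1\<close> of \<open>T\<close>, where
  \<open>i + k = n + 1\<close>.\<close>

lemma left_companion_SpT_iff:
  assumes "num_parts \<mu> \<le> n"
  shows "left_companion n lam T \<in> SpT n \<mu> \<longleftrightarrow>
    (\<forall>i j. i < n \<and> (n + i + 1, j) \<in> diagram lam \<longrightarrow> 2 * i + 1 \<le> T (n + i + 1) j)"
    (is "_ \<longleftrightarrow> ?R")
proof -
  let ?G = "left_companion n lam T"
  have key: "2 * k - 1 \<le> ?G k 1 \<longleftrightarrow> (\<forall>j. (n + i + 1, j) \<in> diagram lam \<longrightarrow> 2 * i + 1 \<le> T (n + i + 1) j)"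
    if k: "1 \<le> k" "k \<le> num_parts \<mu>" and ik: "i + k = n + 1" for i k
  proof (cases "k = 1")
    \<comment> \<open>Now \<open>i = n\<close> and both sides hold: companion entries are positive
      and row \<open>2 * n + 1\<close> of \<open>lam\<close> is empty. The general computation needs
      \<open>k \<le> 2 * k - 2\<close>, which fails here.\<close>
    case True
    have "(k, 1) \<in> diagram \<mu>" using k partition_pos_iff[OF \<mu>(1), of k] by (auto simp: diagram_iff)
    then have "1 \<le> ?G k 1"
      using left_companion_SST skew_SSTD(3)[of ?G "2 * n" \<mu> "\<lambda>_. 0" k 1]
      by (simp add: SST_def diagram_iff)
    moreover have "(n + i + 1, j) \<notin> diagram lam" for j
      using diagram_row_le[of "n + i + 1" j] True ik by auto
    ultimately show ?thesis using True by simp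
  next
    case False
    have k\<mu>: "(k, 1) \<in> diagram \<mu>" using k partition_pos_iff[OF \<mu>(1), of k] by (auto simp: diagram_iff)
    have k2: "2 * k - 2 \<le> 2 * n" "2 * n - (2 * k - 2) + k = n + i + 1" "2 * n + 1 - (2 * k - 2) = 2 * i + 1"
      "k \<le> 2 * k - 2"
      using False k assms ik by auto
    have "2 * k - 1 \<le> ?G k 1 \<longleftrightarrow> \<not> ?G k 1 \<le> 2 * k - 2" using k by auto
    also have "\<dots> \<longleftrightarrow> left_pattern n lam T (2 * k - 2) k = 0"
      using left_pattern_conv_companion[OF k2(1) k(1), of 1] k\<mu> by auto
    also have "\<dots> \<longleftrightarrow> count_below lam T (n + i + 1) (2 * i + 1) = 0"
      using k k2 by (simp add: left_pattern_eq)
    also have "\<dots> \<longleftrightarrow> (\<forall>j. (n + i + 1, j) \<in> diagram lam \<longrightarrow> 2 * i + 1 \<le> T (n + i + 1) j)"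
      unfolding count_below_def card_0_eq[OF finite_row] by auto
    finally show ?thesis .
  qed
  \<comment> \<open>These rows of \<open>T\<close> correspond to no row of \<open>\<mu>\<close>, so
    symplecticity says nothing about them. Their bound is automatic: a smaller entry would give
    \<open>\<mu>\<close> a cell in row \<open>n + 1 - i\<close>.\<close>
  have high: "2 * i + 1 \<le> T (n + i + 1) j"
    if i: "i < n" "n + 1 - i > num_parts \<mu>" and cell: "(n + i + 1, j) \<in> diagram lam" for i j
  proof (rule ccontr)
    assume "\<not> ?thesis"
    then have "j \<le> count_below lam T (n + i + 1) (2 * i + 1)"
      using le_count_below_iff[OF T, of j "n + i + 1"] cell by (simp add: diagram_iff)
    moreover have "left_pattern n lam T (2 * (n - i)) (n + 1 - i)
        = count_below lam T (n + i + 1) (2 * i + 1)"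
    proof -
      have "2 * n - 2 * (n - i) + (n + 1 - i) = n + i + 1" "2 * n + 1 - 2 * (n - i) = 2 * i + 1"
        "n + 1 - i \<le> 2 * (n - i)"
        using i by auto
      then show ?thesis using i by (simp add: left_pattern_eq)
    qed
    ultimately have "(n + 1 - i, j) \<in> diagram \<mu>"
      using left_pattern_conv_companion[of "2 * (n - i)" "n + 1 - i" j] cell i by (simp add: diagram_iff)
    then show False
      using partition_pos_iff[OF \<mu>(1), of "n + 1 - i"] i by (simp add: diagram_iff)
  qed
  show ?thesis
  proof
    assume "?G \<in> SpT n \<mu>"
    then have sp: "2 * k - 1 \<le> ?G k 1" if "1 \<le> k" "k \<le> num_parts \<mu>" for k
      using that by (auto simp: SpT_def)
    show ?R
    proof (intro allI impI, elim conjE)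
      fix i j assume i: "i < n" and cell: "(n + i + 1, j) \<in> diagram lam"
      show "2 * i + 1 \<le> T (n + i + 1) j"
      proof (cases "n + 1 - i \<le> num_parts \<mu>")
        case True
        then show ?thesis using key[of "n + 1 - i" i] sp[of "n + 1 - i"] i cell by simp
      qed (use high i cell in simp)
    qed
  next
    assume R: ?R
    have "2 * k - 1 \<le> ?G k 1" if k: "1 \<le> k" "k \<le> num_parts \<mu>" for k
    proof (cases "k = 1")
      case True
      have "(n + n + 1, j) \<notin> diagram lam" for j
        using diagram_row_le[of "n + n + 1" j] by auto
      then show ?thesis using key[of k n] k True by simp
    next
      case False
      then have "n + 1 - k < n" "n + 1 - k + k = n + 1" using k assms by auto
      then show ?thesis using key[OF k, of "n + 1 - k"] R by blast
    qed
    then show "?G \<in> SpT n \<mu>" using left_companion_SST by (auto simp: SpT_def)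
  qed
qed

text \<open>Induction down the first column, which is strict below row \<open>n\<close>. An entry of
  at least \<open>2 * i + 2\<close> is followed by one of at least \<open>2 * i + 3\<close>, and the
  Sundaram property excludes equality. The first column bounds the rest of each row.\<close>

lemma Sundaram_low_rows:
  assumes "num_parts \<mu> \<le> n"
    and sund: "\<And>k j i. (k, j) \<in> diagram lam \<Longrightarrow> T k j = 2 * i + 1 \<Longrightarrow> k \<le> n + i"
    and cell: "(n + i + 1, j) \<in> diagram lam"
  shows "2 * i + 2 \<le> T (n + i + 1) j"
proof -
  have out: "(n + i + 1, 1) \<notin> diagram \<mu>" for i
    using partition_pos_iff[OF \<mu>(1), of "n + i + 1"] assms(1) by (auto simp: diagram_iff)
  have skip: "T (n + i + 1) 1 \<noteq> 2 * i + 1" if "(n + i + 1, 1) \<in> diagram lam" for i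
    using sund[OF that, of i] by auto
  have "2 * i + 2 \<le> T (n + i + 1) 1" if "(n + i + 1, 1) \<in> diagram lam" for i
    using that
  proof (induction i)
    case 0
    then show ?case using skip[of 0] out[of 0] skew_SSTD(3)[OF T, of "n + 0 + 1" 1] by simp
  next
    case (Suc i)
    have "(n + i + 1, 1) \<in> diagram lam"
      using Suc.prems partition_antimono[OF lam(1), of "n + i + 1" "n + Suc i + 1"]
      by (simp add: diagram_iff)
    then have "2 * i + 2 < T (n + Suc i + 1) 1"
      using Suc.IH skew_SSTD(5)[OF T _ out Suc.prems out, of i] by simp
    then show ?case using skip[OF Suc.prems] by simp
  qed
  moreover have "(n + i + 1, 1) \<in> diagram lam" using cell by (simp add: diagram_iff)
  ultimately show ?thesis
    using skew_SSTD(4)[OF T cell, of 1] cell by (fastforce simp: diagram_iff)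
qed

end

section \<open>Littlewood-Richardson tableaux: injectivity and the Sundaram property\<close>

lemma LR_skew_tableau:
  assumes "is_partition lam" "num_parts lam \<le> 2 * n" "is_partition \<mu>" "\<mu> \<le> lam" "T \<in> LR n lam \<mu> \<nu>"
  shows "skew_tableau n lam \<mu> T"
  using assms by unfold_locales (auto simp: LR_def)

lemma LR_entry_le_row:
  assumes "is_partition lam" "T \<in> LR n lam \<mu> \<nu>" "(i, j) \<in> diagram lam"
  shows "T i j \<le> i"
proof (cases "T i j = 0")
  case False
  have "T \<in> skew_SST (2 * n) lam \<mu>" "yamanouchi (reverse_row_word lam T)"
    using assms(2) by (auto simp: LR_def)
  moreover have "1 \<le> i" "i \<le> num_parts lam"
    using assms(3) partition_pos_iff[OF assms(1), of i] by (auto simp: diagram_iff)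
  ultimately show ?thesis
    using yamanouchi_entry_le_row[of T _ lam \<mu> i "T i j"] set_row_word[of i "T i j" lam T] False assms(3)
    by auto
qed simp

text \<open>An entry is determined by the bounds \<open>r\<close> that it stays below. The pattern
  decides this for \<open>1 \<le> r \<le> i\<close>; for \<open>r > i\<close> the answer is always
  yes, by \<open>LR_entry_le_row\<close>.\<close>

lemma left_companion_inj_on:
  assumes "is_partition lam" "num_parts lam \<le> 2 * n" "is_partition \<mu>" "\<mu> \<le> lam"
  shows "inj_on (left_companion n lam) (LR n lam \<mu> \<nu>)"
proof (rule inj_onI)
  fix T U assume T: "T \<in> LR n lam \<mu> \<nu>" and U: "U \<in> LR n lam \<mu> \<nu>"
    and eq: "left_companion n lam T = left_companion n lam U"
  interpret T: skew_tableau n lam \<mu> T using LR_skew_tableau[OF assms T] .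
  interpret U: skew_tableau n lam \<mu> U using LR_skew_tableau[OF assms U] .
  have pat: "left_pattern n lam T k i = left_pattern n lam U k i" if "k \<le> 2 * n" "1 \<le> i" for k i
  proof (rule antisym)
    show "left_pattern n lam T k i \<le> left_pattern n lam U k i"
      using T.left_pattern_conv_companion[OF that] U.left_pattern_conv_companion[OF that] eq
      by (intro nat_leI[of "left_pattern n lam T k i"]) auto
    show "left_pattern n lam U k i \<le> left_pattern n lam T k i"
      using T.left_pattern_conv_companion[OF that] U.left_pattern_conv_companion[OF that] eq
      by (intro nat_leI[of "left_pattern n lam U k i"]) auto
  qed
  have less: "T i j < r \<longleftrightarrow> U i j < r" if cell: "(i, j) \<in> diagram lam" for i j r
  proof (cases "r \<le> i")
    case True
    show ?thesis
    proof (cases "r = 0")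
      case False
      \<comment> \<open>The member whose bound on the entries is \<open>r\<close>; row
        \<open>i\<close> of the tableau supplies its part \<open>i + 1 - r\<close>.\<close>
      define k where "k = 2 * n + 1 - r"
      have i: "i \<le> 2 * n" using T.diagram_row_le[OF cell] .
      have k: "k \<le> 2 * n" "1 \<le> i + 1 - r" "i + 1 - r \<le> k" "2 * n - k + (i + 1 - r) = i" "2 * n + 1 - k = r"
        using True False i by (auto simp: k_def)
      have "count_below lam T i r = count_below lam U i r"
        using pat[OF k(1,2)] k(2,3) unfolding left_pattern_eq[OF k(1)] k(4,5) by simp
      then show ?thesis
        using le_count_below_iff[OF T.T, of j i r] le_count_below_iff[OF U.T, of j i r] cell
        by (simp add: diagram_iff)
    qed simp
  next
    case False
    then show ?thesis
      using LR_entry_le_row[OF assms(1) T cell] LR_entry_le_row[OF assms(1) U cell] by simp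
  qed
  show "T = U"
  proof (intro ext)
    fix i j
    show "T i j = U i j"
    proof (cases "(i, j) \<in> diagram lam")
      case True
      then show ?thesis using less[OF True, of "T i j"] less[OF True, of "U i j"] by simp
    qed (use skew_SSTD(1)[OF T.T] skew_SSTD(1)[OF U.T] in simp)
  qed
qed

lemma left_companion_SpT_iff_LRS:
  assumes "is_partition lam" "num_parts lam \<le> 2 * n" "is_partition \<mu>" "\<mu> \<le> lam" "num_parts \<mu> \<le> n"
    and even: "even_partition \<nu>" and TLR: "T \<in> LR n lam \<mu> \<nu>"
  shows "left_companion n lam T \<in> SpT n \<mu> \<longleftrightarrow> T \<in> LRS n lam \<mu> \<nu>"
proof -
  interpret skew_tableau n lam \<mu> T using LR_skew_tableau[OF assms(1-4) TLR] .
  have T': "yamanouchi (reverse_row_word lam T)" "tableau_weight lam T = \<nu>"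
    using TLR by (auto simp: LR_def)
  show ?thesis
    unfolding left_companion_SpT_iff[OF assms(5)]
  proof
    assume R: "\<forall>i j. i < n \<and> (n + i + 1, j) \<in> diagram lam \<longrightarrow> 2 * i + 1 \<le> T (n + i + 1) j"
    \<comment> \<open>Each lower row \<open>k\<close> satisfies \<open>R\<close> with its own index
      \<open>k - n - 1\<close>, which is at least \<open>i\<close>.\<close>
    have low: "2 * i + 1 \<le> T k j" if cell: "(k, j) \<in> diagram lam" "n + i + 1 \<le> k" for i j k
    proof -
      have "k - n - 1 < n" "n + (k - n - 1) + 1 = k" using diagram_row_le[OF cell(1)] cell(2) by auto
      then have "2 * (k - n - 1) + 1 \<le> T k j" using R[rule_format, of "k - n - 1" j] cell by simp
      then show ?thesis using cell by simp
    qed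
    have "k \<le> n + i" if cell: "(k, j) \<in> diagram lam" "T k j = 2 * i + 1" for k j i
    proof (rule ccontr)
      assume "\<not> k \<le> n + i"
      \<comment> \<open>Evenness pairs the letters \<open>2 * i + 1\<close> and
        \<open>2 * i + 2\<close>.\<close>
      have "\<nu> (2 * Suc i - 1) = \<nu> (2 * Suc i)"
        using even unfolding even_partition_def by (metis le_add1 plus_1_eq_Suc)
      then have "tableau_weight lam T (2 * i + 1) = tableau_weight lam T (Suc (2 * i + 1))"
        using T'(2) by simp
      then obtain k' j' where "k < k'" "(k', j') \<in> diagram lam" "T k' j' = Suc (2 * i + 1)"
        using yamanouchi_matching_entry_below[OF lam(1) T T'(1) _ cell] by auto
      \<comment> \<open>Row \<open>k'\<close> is at least \<open>n + Suc i + 1\<close>, so its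
        entries are at least \<open>2 * i + 3\<close>, yet it contains
        \<open>2 * i + 2\<close>.\<close>
      then show False using low[of k' j' "Suc i"] \<open>\<not> k \<le> n + i\<close> by simp
    qed
    then show "T \<in> LRS n lam \<mu> \<nu>" using TLR unfolding LRS_def by blast
  next
    assume "T \<in> LRS n lam \<mu> \<nu>"
    then have "\<And>k j i. (k, j) \<in> diagram lam \<Longrightarrow> T k j = 2 * i + 1 \<Longrightarrow> k \<le> n + i"
      by (simp add: LRS_def)
    then show "\<forall>i j. i < n \<and> (n + i + 1, j) \<in> diagram lam \<longrightarrow> 2 * i + 1 \<le> T (n + i + 1) j"
      using Sundaram_low_rows[OF assms(5)] by fastforce
  qed
qed

theorem corollary3:
  fixes n :: nat and lam \<mu> \<nu> :: "nat \<Rightarrow> nat"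
  assumes "is_partition lam" and "num_parts lam \<le> 2 * n"
    and "is_partition \<mu>" and "\<mu> \<le> lam" and "num_parts \<mu> \<le> n"
    and "is_partition \<nu>" and "\<nu> \<le> lam" and "even_partition \<nu>"
  shows "left_LR n lam \<mu> \<nu> \<inter> SpT n \<mu> = left_LRS n lam \<mu> \<nu>
       \<and> bij_betw (left_companion n lam) (LRS n lam \<mu> \<nu>) (left_LR n lam \<mu> \<nu> \<inter> SpT n \<mu>)"
proof -
  have sub: "LRS n lam \<mu> \<nu> \<subseteq> LR n lam \<mu> \<nu>" by (auto simp: LRS_def)
  have eq: "left_LR n lam \<mu> \<nu> \<inter> SpT n \<mu> = left_LRS n lam \<mu> \<nu>"
    using left_companion_SpT_iff_LRS[OF assms(1-5,8)] sub
    by (auto simp: left_LR_def left_LRS_def)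
  moreover have "inj_on (left_companion n lam) (LRS n lam \<mu> \<nu>)"
    using left_companion_inj_on[OF assms(1-4)] sub by (rule inj_on_subset)
  \<comment> \<open>By \<open>eq\<close> the target is the image of \<open>LRS\<close>, so
    surjectivity is immediate.\<close>
  ultimately show ?thesis by (simp add: bij_betw_def left_LRS_def)
qed

end
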